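(* Let $H$ be a malnormal subgroup of a group $G$. Let $\tilde G=(G\setminus H)^2/H^3$ be the associated groupoid, let $\Gamma(\tilde G)\subset\tilde G$ be its set of non-identity morphisms, and let $j\colon\Gamma(\tilde G)\to\Gamma(\tilde G)$, $(g_1,g_2)H^3\mapsto (g_1^{-1},g_1^{-1}g_2)H^3$. Then the groupoid $\mathcal{G}_{G,H}=\tilde G$ is a $\Delta$-groupoid with distinguished generating subset $\Gamma(\tilde G)$ and involution $j$.
   Context: A subgroup $H$ of a group $G$ is malnormal if $gHg^{-1}\cap H\neq\{1\}$ implies $g\in H$. Groupoid convention: a groupoid is identified with its set of morphisms; $(x,y)$ is composable iff $\mathrm{cod}(x)=\mathrm{dom}(y)$, and the composite is written $xy$. $\Delta$-groupoid: a groupoid $\mathcal G$ with a subset $D\subset\mathcal G$ generating $\mathcal G$ as a groupoid and an involution $j\colon D\to D$ such that (i) $i(D)=D$ where $i(x)=x^{-1}$; (ii) $iji=jij$ on $D$; (iii) if $(x,y)\in D^2$ is composable then $(k(x),j(y))$ is composable, where $k=iji$; (iv) if $(x,y)\in D^2$ is $D$-composable (i.e. composable with $xy\in D$), then $(k(x),j(y))$ is also $D$-composable and $k(xy)\,i(k(y))=k(k(x)j(y))$. The groupoid $\tilde G$: the group $H^3$ acts on the right on $(G\setminus H)^2$ by $(g_1,g_2)(h_1,h_2,h_3)=(h_1^{-1}g_1h_2,\,h_1^{-1}g_2h_3)$, and $\tilde G$ is the set of orbits. The objects are the double cosets $HgH$, $g\in G\setminus H$. Two orbits $(f_1,f_2)H^3$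 and $(g_1,g_2)H^3$ are composable iff $Hf_2H=Hg_1H$, with product $(f_1,f_2)H^3\cdot(g_1,g_2)H^3=(f_1,h_0g_2)H^3$, where $h_0\in H$ is the unique element with $f_2H=h_0g_1H$. The identities are $1_{HgH}=(g,g)H^3$ and the inverse of $(g_1,g_2)H^3$ is $(g_2,g_1)H^3$. *)

theory Defs
  imports "HOL-Algebra.Coset"
begin

section \<open>Groupoids\<close>

text \<open>Composition is written in diagrammatic order: \<open>x \<cdot> y\<close> is meaningful
  when \<open>Cod x = Dom y\<close>.\<close>

record ('o, 'm) groupoid =
  Obj :: "'o set"
  Mor :: "'m set"
  Dom :: "'m \<Rightarrow> 'o"
  Cod :: "'m \<Rightarrow> 'o"
  Idm :: "'o \<Rightarrow> 'm"
  Comp :: "'m \<Rightarrow> 'm \<Rightarrow> 'm" (infixl \<open>\<cdot>\<index>\<close> 70)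
  Inv :: "'m \<Rightarrow> 'm"

definition composable :: "('o, 'm, 'z) groupoid_scheme \<Rightarrow> 'm \<Rightarrow> 'm \<Rightarrow> bool" where
  "composable \<G> x y \<longleftrightarrow> x \<in> Mor \<G> \<and> y \<in> Mor \<G> \<and> Cod \<G> x = Dom \<G> y"

locale groupoid =
  fixes \<G> :: "('o, 'm, 'z) groupoid_scheme" (structure)
  assumes Dom_closed: "x \<in> Mor \<G> \<Longrightarrow> Dom \<G> x \<in> Obj \<G>"
    and Cod_closed: "x \<in> Mor \<G> \<Longrightarrow> Cod \<G> x \<in> Obj \<G>"
    and Idm_closed: "a \<in> Obj \<G> \<Longrightarrow> Idm \<G> a \<in> Mor \<G>"
    and Dom_Idm: "a \<in> Obj \<G> \<Longrightarrow> Dom \<G> (Idm \<G> a) = a"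
    and Cod_Idm: "a \<in> Obj \<G> \<Longrightarrow> Cod \<G> (Idm \<G> a) = a"
    and Comp_closed: "composable \<G> x y \<Longrightarrow> x \<cdot> y \<in> Mor \<G>"
    and Dom_Comp: "composable \<G> x y \<Longrightarrow> Dom \<G> (x \<cdot> y) = Dom \<G> x"
    and Cod_Comp: "composable \<G> x y \<Longrightarrow> Cod \<G> (x \<cdot> y) = Cod \<G> y"
    and Comp_assoc: "composable \<G> x y \<Longrightarrow> composable \<G> y z \<Longrightarrow> (x \<cdot> y) \<cdot> z = x \<cdot> (y \<cdot> z)"
    and Idm_Comp: "x \<in> Mor \<G> \<Longrightarrow> Idm \<G> (Dom \<G> x) \<cdot> x = x"
    and Comp_Idm: "x \<in> Mor \<G> \<Longrightarrow> x \<cdot> Idm \<G> (Cod \<G> x) = x"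
    and Inv_closed: "x \<in> Mor \<G> \<Longrightarrow> Inv \<G> x \<in> Mor \<G>"
    and Dom_Inv: "x \<in> Mor \<G> \<Longrightarrow> Dom \<G> (Inv \<G> x) = Cod \<G> x"
    and Cod_Inv: "x \<in> Mor \<G> \<Longrightarrow> Cod \<G> (Inv \<G> x) = Dom \<G> x"
    and Comp_Inv: "x \<in> Mor \<G> \<Longrightarrow> x \<cdot> Inv \<G> x = Idm \<G> (Dom \<G> x)"
    and Inv_Comp: "x \<in> Mor \<G> \<Longrightarrow> Inv \<G> x \<cdot> x = Idm \<G> (Cod \<G> x)"

text \<open>The subgroupoid generated by \<open>D\<close> is taken with the full set of objects, so it
  contains every identity as an empty product. This matters for groupoids
  having an object whose only morphism is its identity.\<close>

inductive_set groupoid_generate :: "('o, 'm, 'z) groupoid_scheme \<Rightarrow> 'm set \<Rightarrow> 'm set"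
  for \<G> and D where
    Idm: "a \<in> Obj \<G> \<Longrightarrow> Idm \<G> a \<in> groupoid_generate \<G> D"
  | incl: "x \<in> D \<Longrightarrow> x \<in> groupoid_generate \<G> D"
  | Inv: "x \<in> groupoid_generate \<G> D \<Longrightarrow> Inv \<G> x \<in> groupoid_generate \<G> D"
  | Comp: "x \<in> groupoid_generate \<G> D \<Longrightarrow> y \<in> groupoid_generate \<G> D \<Longrightarrow> composable \<G> x y
      \<Longrightarrow> x \<cdot>\<^bsub>\<G>\<^esub> y \<in> groupoid_generate \<G> D"

definition non_identities :: "('o, 'm, 'z) groupoid_scheme \<Rightarrow> 'm set" where
  "non_identities \<G> = Mor \<G> - Idm \<G> ` Obj \<G>"


section \<open>Delta-groupoids\<close>

definition D_composable :: "('o, 'm, 'z) groupoid_scheme \<Rightarrow> 'm set \<Rightarrow> 'm \<Rightarrow> 'm \<Rightarrow> bool" where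
  "D_composable \<G> D x y \<longleftrightarrow> x \<in> D \<and> y \<in> D \<and> composable \<G> x y \<and> x \<cdot>\<^bsub>\<G>\<^esub> y \<in> D"

definition conj_inv :: "('o, 'm, 'z) groupoid_scheme \<Rightarrow> ('m \<Rightarrow> 'm) \<Rightarrow> 'm \<Rightarrow> 'm" where
  "conj_inv \<G> j x = Inv \<G> (j (Inv \<G> x))"

text \<open>Since \<open>Comp\<close> is total in HOL, the implicit claim in axiom (iv) that the left-hand side
  is defined is recorded as a separate axiom.\<close>

locale delta_groupoid = groupoid \<G>
  for \<G> :: "('o, 'm, 'z) groupoid_scheme" (structure) +
  fixes D :: "'m set" and j :: "'m \<Rightarrow> 'm"
  assumes D_subset: "D \<subseteq> Mor \<G>"
    and D_generates: "groupoid_generate \<G> D = Mor \<G>"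
    and j_closed: "x \<in> D \<Longrightarrow> j x \<in> D"
    and j_involution: "x \<in> D \<Longrightarrow> j (j x) = x"
    and Inv_image_D: "Inv \<G> ` D = D"
    and braid: "x \<in> D \<Longrightarrow> Inv \<G> (j (Inv \<G> x)) = j (Inv \<G> (j x))"
    and k_j_composable: "x \<in> D \<Longrightarrow> y \<in> D \<Longrightarrow> composable \<G> x y
      \<Longrightarrow> composable \<G> (conj_inv \<G> j x) (j y)"
    and k_j_D_composable: "D_composable \<G> D x y
      \<Longrightarrow> D_composable \<G> D (conj_inv \<G> j x) (j y)"
    and k_Comp_defined: "D_composable \<G> D x y
      \<Longrightarrow> composable \<G> (conj_inv \<G> j (x \<cdot> y)) (Inv \<G> (conj_inv \<G> j y))"
    and k_Comp: "D_composable \<G> D x y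
      \<Longrightarrow> conj_inv \<G> j (x \<cdot> y) \<cdot> Inv \<G> (conj_inv \<G> j y) = conj_inv \<G> j (conj_inv \<G> j x \<cdot> j y)"


section \<open>Malnormal subgroups and the associated groupoid\<close>

definition malnormal :: "'a set \<Rightarrow> ('a, 'b) monoid_scheme \<Rightarrow> bool" where
  "malnormal H G \<longleftrightarrow> subgroup H G \<and>
     (\<forall>g \<in> carrier G. (g <#\<^bsub>G\<^esub> H #>\<^bsub>G\<^esub> inv\<^bsub>G\<^esub> g) \<inter> H \<noteq> {\<one>\<^bsub>G\<^esub>} \<longrightarrow> g \<in> H)"

definition double_coset :: "('a, 'b) monoid_scheme \<Rightarrow> 'a set \<Rightarrow> 'a \<Rightarrow> 'a set" where
  "double_coset G H g = (H #>\<^bsub>G\<^esub> g) <#>\<^bsub>G\<^esub> H"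

definition pair_act :: "('a, 'b) monoid_scheme \<Rightarrow> 'a \<times> 'a \<Rightarrow> 'a \<times> 'a \<times> 'a \<Rightarrow> 'a \<times> 'a" where
  "pair_act G = (\<lambda>(g1, g2) (h1, h2, h3).
     (inv\<^bsub>G\<^esub> h1 \<otimes>\<^bsub>G\<^esub> g1 \<otimes>\<^bsub>G\<^esub> h2, inv\<^bsub>G\<^esub> h1 \<otimes>\<^bsub>G\<^esub> g2 \<otimes>\<^bsub>G\<^esub> h3))"

definition pair_orbit :: "('a, 'b) monoid_scheme \<Rightarrow> 'a set \<Rightarrow> 'a \<Rightarrow> 'a \<Rightarrow> ('a \<times> 'a) set" where
  "pair_orbit G H g1 g2 = pair_act G (g1, g2) ` (H \<times> H \<times> H)"

text \<open>A map given on representatives is written as \<open>the_elem\<close> of the set of values taken over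
  all representatives; for the groupoid structure, independence of the representatives is
  proved below.\<close>

definition pair_groupoid ::
    "('a, 'b) monoid_scheme \<Rightarrow> 'a set \<Rightarrow> ('a set, ('a \<times> 'a) set) groupoid" where
  "pair_groupoid G H =
    \<lparr> Obj = {double_coset G H g | g. g \<in> carrier G - H},
      Mor = {pair_orbit G H g1 g2 | g1 g2. g1 \<in> carrier G - H \<and> g2 \<in> carrier G - H},
      Dom = (\<lambda>X. the_elem {double_coset G H g1 | g1 g2. (g1, g2) \<in> X}),
      Cod = (\<lambda>X. the_elem {double_coset G H g2 | g1 g2. (g1, g2) \<in> X}),
      Idm = (\<lambda>A. the_elem {pair_orbit G H g g | g. g \<in> A}),
      Comp = (\<lambda>X Y. the_elem {pair_orbit G H f1 (h0 \<otimes>\<^bsub>G\<^esub> g2) | f1 f2 g1 g2 h0.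
                (f1, f2) \<in> X \<and> (g1, g2) \<in> Y \<and> h0 \<in> H \<and> f2 <#\<^bsub>G\<^esub> H = (h0 \<otimes>\<^bsub>G\<^esub> g1) <#\<^bsub>G\<^esub> H}),
      Inv = (\<lambda>X. the_elem {pair_orbit G H g2 g1 | g1 g2. (g1, g2) \<in> X}) \<rparr>"

definition pair_j :: "('a, 'b) monoid_scheme \<Rightarrow> 'a set \<Rightarrow> ('a \<times> 'a) set \<Rightarrow> ('a \<times> 'a) set" where
  "pair_j G H X =
     the_elem {pair_orbit G H (inv\<^bsub>G\<^esub> g1) (inv\<^bsub>G\<^esub> g1 \<otimes>\<^bsub>G\<^esub> g2) | g1 g2. (g1, g2) \<in> X}"


subsection \<open>Independence of representatives\<close>

context group
begin

lemma inv_mult_cancel: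
  assumes "x \<in> carrier G" "y \<in> carrier G"
  shows "inv x \<otimes> (x \<otimes> y) = y" "x \<otimes> (inv x \<otimes> y) = y"
  using assms by (simp_all add: m_assoc [symmetric])

lemma pair_orbit_mem:
  "(a, b) \<in> pair_orbit G H g1 g2 \<longleftrightarrow>
    (\<exists>h1\<in>H. \<exists>h2\<in>H. \<exists>h3\<in>H. a = inv h1 \<otimes> g1 \<otimes> h2 \<and> b = inv h1 \<otimes> g2 \<otimes> h3)"
  unfolding pair_orbit_def pair_act_def by force

lemma pair_orbit_self:
  assumes "subgroup H G" "g1 \<in> carrier G" "g2 \<in> carrier G"
  shows "(g1, g2) \<in> pair_orbit G H g1 g2"
  unfolding pair_orbit_mem using assms subgroup.one_closed[OF assms(1)] by force

lemma pair_orbit_sub: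
  assumes H: "subgroup H G" and g: "g1 \<in> carrier G" "g2 \<in> carrier G"
    and ab: "(a, b) \<in> pair_orbit G H g1 g2"
  shows "pair_orbit G H a b \<subseteq> pair_orbit G H g1 g2" "(g1, g2) \<in> pair_orbit G H a b"
proof -
  note sc = subgroup.mem_carrier[OF H]
  obtain h1 h2 h3 where h: "h1 \<in> H" "h2 \<in> H" "h3 \<in> H"
    and a: "a = inv h1 \<otimes> g1 \<otimes> h2" and b: "b = inv h1 \<otimes> g2 \<otimes> h3"
    using ab unfolding pair_orbit_mem by blast
  show "pair_orbit G H a b \<subseteq> pair_orbit G H g1 g2"
  proof clarify
    fix c d assume "(c, d) \<in> pair_orbit G H a b"
    then obtain k1 k2 k3 where k: "k1 \<in> H" "k2 \<in> H" "k3 \<in> H"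
      and c: "c = inv k1 \<otimes> a \<otimes> k2" and d: "d = inv k1 \<otimes> b \<otimes> k3"
      unfolding pair_orbit_mem by blast
    have "c = inv (h1 \<otimes> k1) \<otimes> g1 \<otimes> (h2 \<otimes> k2)" "d = inv (h1 \<otimes> k1) \<otimes> g2 \<otimes> (h3 \<otimes> k3)"
      unfolding a b c d using h k g sc by (simp_all add: m_assoc inv_mult_group)
    then show "(c, d) \<in> pair_orbit G H g1 g2"
      unfolding pair_orbit_mem using h k subgroup.m_closed[OF H] by blast
  qed
  have "g1 = inv (inv h1) \<otimes> a \<otimes> inv h2" "g2 = inv (inv h1) \<otimes> b \<otimes> inv h3"
    unfolding a b using h g sc by (simp_all add: m_assoc inv_mult_cancel)
  then show "(g1, g2) \<in> pair_orbit G H a b"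
    unfolding pair_orbit_mem using h subgroup.m_inv_closed[OF H] by blast
qed

lemma pair_orbit_eq:
  assumes H: "subgroup H G" and g: "g1 \<in> carrier G" "g2 \<in> carrier G"
    and ab: "(a, b) \<in> pair_orbit G H g1 g2"
  shows "pair_orbit G H a b = pair_orbit G H g1 g2"
proof -
  have "a \<in> carrier G" "b \<in> carrier G"
    using ab g subgroup.mem_carrier[OF H] unfolding pair_orbit_mem by auto
  then show ?thesis
    using pair_orbit_sub[OF H g ab] pair_orbit_sub(1)[OF H _ _ pair_orbit_sub(2)[OF H g ab]] by blast
qed

lemma double_coset_mem:
  "a \<in> double_coset G H g \<longleftrightarrow> (\<exists>h\<in>H. \<exists>h'\<in>H. a = h \<otimes> g \<otimes> h')"
  unfolding double_coset_def set_mult_def r_coset_def by blast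

lemma double_coset_self:
  assumes "subgroup H G" "g \<in> carrier G"
  shows "g \<in> double_coset G H g"
  unfolding double_coset_mem using assms subgroup.one_closed[OF assms(1)] by force

lemma double_coset_eq:
  assumes H: "subgroup H G" and g: "g \<in> carrier G" and h: "h \<in> H" "h' \<in> H"
  shows "double_coset G H (h \<otimes> g \<otimes> h') = double_coset G H g"
proof -
  note sc = subgroup.mem_carrier[OF H] and mc = subgroup.m_closed[OF H]
    and ic = subgroup.m_inv_closed[OF H]
  have "k \<otimes> (h \<otimes> g \<otimes> h') \<otimes> k' = (k \<otimes> h) \<otimes> g \<otimes> (h' \<otimes> k')"
    "k \<otimes> g \<otimes> k' = (k \<otimes> inv h) \<otimes> (h \<otimes> g \<otimes> h') \<otimes> (inv h' \<otimes> k')" if "k \<in> H" "k' \<in> H" for k k'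
    using that h g sc by (simp_all add: m_assoc inv_mult_cancel)
  then show ?thesis
    unfolding set_eq_iff double_coset_mem using h mc ic by (metis (no_types, lifting))
qed

lemma pair_groupoid_Dom:
  assumes H: "subgroup H G" and g: "g1 \<in> carrier G" "g2 \<in> carrier G"
  shows "Dom (pair_groupoid G H) (pair_orbit G H g1 g2) = double_coset G H g1"
proof -
  have "double_coset G H a = double_coset G H g1" if "(a, b) \<in> pair_orbit G H g1 g2" for a b
    using that double_coset_eq[OF H g(1)] subgroup.m_inv_closed[OF H]
    by (auto simp: pair_orbit_mem)
  then have "{double_coset G H a | a b. (a, b) \<in> pair_orbit G H g1 g2} = {double_coset G H g1}"
    using pair_orbit_self[OF H g] by blast
  then show ?thesis by (simp add: pair_groupoid_def)
qed

lemma pair_groupoid_Cod: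
  assumes H: "subgroup H G" and g: "g1 \<in> carrier G" "g2 \<in> carrier G"
  shows "Cod (pair_groupoid G H) (pair_orbit G H g1 g2) = double_coset G H g2"
proof -
  have "double_coset G H b = double_coset G H g2" if "(a, b) \<in> pair_orbit G H g1 g2" for a b
    using that double_coset_eq[OF H g(2)] subgroup.m_inv_closed[OF H]
    by (auto simp: pair_orbit_mem)
  then have "{double_coset G H b | a b. (a, b) \<in> pair_orbit G H g1 g2} = {double_coset G H g2}"
    using pair_orbit_self[OF H g] by blast
  then show ?thesis by (simp add: pair_groupoid_def)
qed

lemma pair_groupoid_Idm:
  assumes H: "subgroup H G" and g: "g \<in> carrier G"
  shows "Idm (pair_groupoid G H) (double_coset G H g) = pair_orbit G H g g"
proof -
  have "pair_orbit G H (h \<otimes> g \<otimes> h') (h \<otimes> g \<otimes> h') = pair_orbit G H g g" if "h \<in> H" "h' \<in> H" for h h'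
  proof (rule pair_orbit_eq[OF H g g])
    have "h = inv (inv h)" using that subgroup.mem_carrier[OF H] by simp
    then show "(h \<otimes> g \<otimes> h', h \<otimes> g \<otimes> h') \<in> pair_orbit G H g g"
      unfolding pair_orbit_mem using that subgroup.m_inv_closed[OF H] by metis
  qed
  then have "{pair_orbit G H a a | a. a \<in> double_coset G H g} = {pair_orbit G H g g}"
    using double_coset_self[OF H g] unfolding double_coset_mem by blast
  then show ?thesis by (simp add: pair_groupoid_def)
qed

lemma pair_groupoid_Inv:
  assumes H: "subgroup H G" and g: "g1 \<in> carrier G" "g2 \<in> carrier G"
  shows "Inv (pair_groupoid G H) (pair_orbit G H g1 g2) = pair_orbit G H g2 g1"
proof -
  have "pair_orbit G H b a = pair_orbit G H g2 g1" if "(a, b) \<in> pair_orbit G H g1 g2" for a b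
    using that by (intro pair_orbit_eq[OF H g(2,1)]) (auto simp: pair_orbit_mem)
  then have "{pair_orbit G H b a | a b. (a, b) \<in> pair_orbit G H g1 g2} = {pair_orbit G H g2 g1}"
    using pair_orbit_self[OF H g] by blast
  then show ?thesis by (simp add: pair_groupoid_def)
qed

lemma lcoset_eq_imp:
  assumes H: "subgroup H G" and "a \<in> carrier G" "b \<in> carrier G" "a <# H = b <# H"
  shows "\<exists>h\<in>H. a = b \<otimes> h"
proof -
  have "a \<in> a <# H"
    unfolding l_coset_def using assms subgroup.one_closed[OF H] by force
  then show ?thesis using assms(4) unfolding l_coset_def by auto
qed

lemma malnormal_unique:
  assumes M: "malnormal H G" and g: "g \<in> carrier G - H"
    and h: "h \<in> H" "h' \<in> H" and e: "(h \<otimes> g) <# H = (h' \<otimes> g) <# H"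
  shows "h = h'"
proof -
  have H: "subgroup H G" using M by (simp add: malnormal_def)
  note sc = subgroup.mem_carrier[OF H]
  obtain k where k: "k \<in> H" "h \<otimes> g = h' \<otimes> g \<otimes> k"
    using lcoset_eq_imp[OF H _ _ e] g h sc by auto
  have "inv h' \<otimes> h = inv h' \<otimes> (h \<otimes> g) \<otimes> inv g"
    using g h sc by (simp add: m_assoc)
  also have "\<dots> = g \<otimes> k \<otimes> inv g"
    unfolding k(2) using g h k(1) sc by (simp add: m_assoc inv_mult_cancel)
  finally have eq: "inv h' \<otimes> h = g \<otimes> k \<otimes> inv g" .
  have "g \<otimes> k \<otimes> inv g \<in> g <# H #> inv g"
    using k(1) unfolding l_coset_def r_coset_def by blast
  moreover have "inv h' \<otimes> h \<in> H"
    using h subgroup.m_closed[OF H] subgroup.m_inv_closed[OF H] by blast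
  ultimately have "inv h' \<otimes> h \<in> (g <# H #> inv g) \<inter> H"
    by (simp add: eq)
  moreover have "(g <# H #> inv g) \<inter> H = {\<one>}"
    using M g unfolding malnormal_def by blast
  ultimately have "inv h' \<otimes> h = \<one>" by blast
  then show ?thesis using h sc by (metis inv_closed inv_inv inv_equality)
qed

lemma malnormal_ex1:
  assumes M: "malnormal H G" and g: "f2 \<in> carrier G" "g1 \<in> carrier G - H"
    and e: "double_coset G H f2 = double_coset G H g1"
  shows "\<exists>!h0. h0 \<in> H \<and> f2 <# H = (h0 \<otimes> g1) <# H"
proof -
  have H: "subgroup H G" using M by (simp add: malnormal_def)
  obtain h h' where h: "h \<in> H" "h' \<in> H" "f2 = h \<otimes> g1 \<otimes> h'"
    using double_coset_self[OF H g(1)] unfolding e double_coset_mem by blast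
  have "f2 \<in> (h \<otimes> g1) <# H" using h unfolding l_coset_def by blast
  then have "f2 <# H = (h \<otimes> g1) <# H"
    using l_repr_independence[OF _ _ H] g h subgroup.mem_carrier[OF H] by (metis DiffD1 m_closed)
  then show ?thesis
    using h malnormal_unique[OF M g(2)] by metis
qed

lemma pair_groupoid_Comp:
  assumes M: "malnormal H G"
    and f: "f1 \<in> carrier G - H" "f2 \<in> carrier G - H"
    and g: "g1 \<in> carrier G - H" "g2 \<in> carrier G - H"
    and h0: "h0 \<in> H" "f2 <# H = (h0 \<otimes> g1) <# H"
  shows "pair_orbit G H f1 f2 \<cdot>\<^bsub>pair_groupoid G H\<^esub> pair_orbit G H g1 g2
         = pair_orbit G H f1 (h0 \<otimes> g2)"
proof -
  have H: "subgroup H G" using M by (simp add: malnormal_def)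
  note sc = subgroup.mem_carrier[OF H] and mc = subgroup.m_closed[OF H]
    and ic = subgroup.m_inv_closed[OF H]
  have *: "pair_orbit G H a1 (k0 \<otimes> b2) = pair_orbit G H f1 (h0 \<otimes> g2)"
    if a: "(a1, a2) \<in> pair_orbit G H f1 f2" and b: "(b1, b2) \<in> pair_orbit G H g1 g2"
      and k0: "k0 \<in> H" "a2 <# H = (k0 \<otimes> b1) <# H" for a1 a2 b1 b2 k0
  proof -
    obtain u1 u2 u3 where u: "u1 \<in> H" "u2 \<in> H" "u3 \<in> H"
      "a1 = inv u1 \<otimes> f1 \<otimes> u2" "a2 = inv u1 \<otimes> f2 \<otimes> u3"
      using a unfolding pair_orbit_mem by blast
    obtain v1 v2 v3 where v: "v1 \<in> H" "v2 \<in> H" "v3 \<in> H"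
      "b1 = inv v1 \<otimes> g1 \<otimes> v2" "b2 = inv v1 \<otimes> g2 \<otimes> v3"
      using b unfolding pair_orbit_mem by blast
    obtain w where w: "w \<in> H" "a2 = k0 \<otimes> b1 \<otimes> w"
      using lcoset_eq_imp[OF H _ _ k0(2)] u v f g k0 sc by auto
    define z where "z = u1 \<otimes> k0 \<otimes> inv v1"
    have z: "z \<in> H" unfolding z_def using u(1) v(1) k0(1) by (intro mc ic)
    have "f2 = u1 \<otimes> a2 \<otimes> inv u3"
      unfolding u(5) using u(1-3) f sc by (simp add: m_assoc inv_mult_cancel)
    also have "\<dots> = (z \<otimes> g1) \<otimes> (v2 \<otimes> w \<otimes> inv u3)"
      unfolding w(2) v(4) z_def using u(1-3) v(1-3) w(1) k0(1) g sc by (simp add: m_assoc)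
    finally have f2: "f2 = (z \<otimes> g1) \<otimes> (v2 \<otimes> w \<otimes> inv u3)" .
    moreover have "v2 \<otimes> w \<otimes> inv u3 \<in> H" using v(2) w(1) u(3) by (intro mc ic)
    ultimately have "f2 \<in> (z \<otimes> g1) <# H"
      unfolding l_coset_def by blast
    then have "f2 <# H = (z \<otimes> g1) <# H"
      using l_repr_independence[OF _ _ H] g z sc by (metis DiffD1 m_closed)
    then have zh: "z = h0"
      using malnormal_unique[OF M g(1) z h0(1) trans[OF sym h0(2)]] by blast
    have "k0 \<otimes> b2 = inv u1 \<otimes> (h0 \<otimes> g2) \<otimes> v3"
      unfolding zh[symmetric] z_def v(5) using u(1-3) v(1-3) k0(1) g sc
      by (simp add: m_assoc inv_mult_cancel)
    then have "(a1, k0 \<otimes> b2) \<in> pair_orbit G H f1 (h0 \<otimes> g2)"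
      unfolding pair_orbit_mem using u v by blast
    then show ?thesis
      using f g h0 sc by (intro pair_orbit_eq[OF H]) auto
  qed
  have "(f1, f2) \<in> pair_orbit G H f1 f2" "(g1, g2) \<in> pair_orbit G H g1 g2"
    using pair_orbit_self[OF H] f g by auto
  then have "{pair_orbit G H a1 (k0 \<otimes> b2) | a1 a2 b1 b2 k0.
      (a1, a2) \<in> pair_orbit G H f1 f2 \<and> (b1, b2) \<in> pair_orbit G H g1 g2 \<and> k0 \<in> H
      \<and> a2 <# H = (k0 \<otimes> b1) <# H} = {pair_orbit G H f1 (h0 \<otimes> g2)}"
    using * h0 by blast
  then show ?thesis by (simp add: pair_groupoid_def)
qed

end

end

theory Submission
  imports Defs
begin

text \<open>Write \<open>[a, b]\<close> for the orbit of \<open>(a, b)\<close>. Representatives of composable morphisms can be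
  aligned as \<open>[a, b]\<close>, \<open>[b, c]\<close>, with product \<open>[a, c]\<close>, so composition is that of a pair groupoid, and
  \<open>[a, b]\<close> is an identity iff \<open>a\<inverse>b \<in> H\<close>. On representatives \<open>j [a, b] = [a\<inverse>, a\<inverse>b]\<close> and
  \<open>k [a, b] = [b\<inverse>a, b\<inverse>]\<close>. Hence \<open>k [a, b]\<close> and \<open>j [b, c]\<close> are aligned again, with product
  \<open>[b\<inverse>a, b\<inverse>c]\<close>, and both sides of axiom (iv) are \<open>[c\<inverse>a, c\<inverse>b]\<close>.\<close>

section \<open>Elements outside the subgroup\<close>

lemma (in group) inv_notin_subgroup:
  assumes "subgroup H G" "a \<in> carrier G - H"
  shows "inv a \<in> carrier G - H"
  using assms subgroup.m_inv_closed[OF assms(1), of "inv a"] by auto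

text \<open>The two quotients are inverse to each other. This transfers the non-identity condition
  from [a, b] to its inverse [b, a].\<close>

lemma (in group) left_quotient_swap_notin_subgroup:
  assumes "subgroup H G" "a \<in> carrier G" "b \<in> carrier G" "inv a \<otimes> b \<notin> H"
  shows "inv b \<otimes> a \<notin> H"
  using subgroup.m_inv_closed[OF assms(1), of "inv b \<otimes> a"] assms(2-4)
  by (auto simp: inv_mult_group)

locale malnormal_subgroup = group G for G :: "('a, 'b) monoid_scheme" (structure) +
  fixes H :: "'a set"
  assumes malnormal: "malnormal H G"
begin

abbreviation orb :: "'a \<Rightarrow> 'a \<Rightarrow> ('a \<times> 'a) set" where "orb \<equiv> pair_orbit G H"
abbreviation PG :: "('a set, ('a \<times> 'a) set) groupoid" where "PG \<equiv> pair_groupoid G H"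

lemma H: "subgroup H G"
  using malnormal by (simp add: malnormal_def)

section \<open>Structure maps on aligned representatives\<close>

lemma Dom_orb: "a \<in> carrier G - H \<Longrightarrow> b \<in> carrier G - H \<Longrightarrow> Dom PG (orb a b) = double_coset G H a"
  and Cod_orb: "a \<in> carrier G - H \<Longrightarrow> b \<in> carrier G - H \<Longrightarrow> Cod PG (orb a b) = double_coset G H b"
  and Inv_orb: "a \<in> carrier G - H \<Longrightarrow> b \<in> carrier G - H \<Longrightarrow> Inv PG (orb a b) = orb b a"
  and Idm_double_coset: "a \<in> carrier G - H \<Longrightarrow> Idm PG (double_coset G H a) = orb a a"
  by (simp_all add: pair_groupoid_Dom pair_groupoid_Cod pair_groupoid_Inv pair_groupoid_Idm H)

lemma orb_in_Mor: "a \<in> carrier G - H \<Longrightarrow> b \<in> carrier G - H \<Longrightarrow> orb a b \<in> Mor PG"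
  by (auto simp: pair_groupoid_def)

lemma double_coset_in_Obj: "a \<in> carrier G - H \<Longrightarrow> double_coset G H a \<in> Obj PG"
  by (auto simp: pair_groupoid_def)

lemma Mor_cases:
  assumes "x \<in> Mor PG"
  obtains a b where "a \<in> carrier G - H" "b \<in> carrier G - H" "x = orb a b"
  using assms by (auto simp: pair_groupoid_def)

lemma Obj_cases:
  assumes "A \<in> Obj PG"
  obtains a where "a \<in> carrier G - H" "A = double_coset G H a"
  using assms by (auto simp: pair_groupoid_def)

lemma composable_orb:
  "a \<in> carrier G - H \<Longrightarrow> b \<in> carrier G - H \<Longrightarrow> c \<in> carrier G - H
    \<Longrightarrow> composable PG (orb a b) (orb b c)"
  by (simp add: composable_def orb_in_Mor Dom_orb Cod_orb)

text \<open>For aligned pairs the connecting element \<open>h0\<close> can be taken to be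
  \<open>\<one>\<close>. Malnormality makes it unique, so this choice determines the
  product.\<close>

lemma Comp_orb:
  assumes "a \<in> carrier G - H" "b \<in> carrier G - H" "c \<in> carrier G - H"
  shows "orb a b \<cdot>\<^bsub>PG\<^esub> orb b c = orb a c"
  using pair_groupoid_Comp[OF malnormal assms(1,2,2,3), of \<one>] assms subgroup.one_closed[OF H]
  by simp

text \<open>Equal double cosets give b = h p h' for a representative (p, q) of \<open>y\<close>, and
  the action of (h^-1, h', 1) moves (p, q) to (b, h q). Only the right factor is re-represented; the
  given pair (a, b) stays fixed, so a chain of morphisms can be aligned one after another.\<close>

lemma composable_orb_left_cases:
  assumes "composable PG (orb a b) y" and a: "a \<in> carrier G - H" and b: "b \<in> carrier G - H"
  obtains c where "c \<in> carrier G - H" "y = orb b c"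
proof -
  note sc = subgroup.mem_carrier[OF H]
  have y: "y \<in> Mor PG" and e: "Cod PG (orb a b) = Dom PG y"
    using assms(1) by (auto simp: composable_def)
  obtain p q where p: "p \<in> carrier G - H" and q: "q \<in> carrier G - H" and y: "y = orb p q"
    using y by (rule Mor_cases)
  have "double_coset G H b = double_coset G H p"
    using e a b p q y by (simp only: Dom_orb Cod_orb)
  then obtain h h' where h: "h \<in> H" "h' \<in> H" "b = h \<otimes> p \<otimes> h'"
    using double_coset_self[OF H, of b] b by (auto simp: double_coset_mem)
  \<comment> \<open>The double inverse matches the left factor \<open>inv h1\<close> of the action,
    with h1 = h^-1.\<close>
  have "b = inv (inv h) \<otimes> p \<otimes> h'" "h \<otimes> q = inv (inv h) \<otimes> q \<otimes> \<one>"
    using h q sc by simp_all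
  then have "(b, h \<otimes> q) \<in> orb p q"
    unfolding pair_orbit_mem
    using h(2) subgroup.m_inv_closed[OF H h(1)] subgroup.one_closed[OF H] by blast
  then have "orb b (h \<otimes> q) = y"
    unfolding y using p q by (intro pair_orbit_eq[OF H]) auto
  moreover have "h \<otimes> q \<in> carrier G - H"
  proof -
    have "inv h \<otimes> (h \<otimes> q) = q" using h q sc by (simp add: inv_mult_cancel)
    then have "h \<otimes> q \<notin> H"
      using q h subgroup.m_closed[OF H] subgroup.m_inv_closed[OF H] by (metis DiffD2)
    then show ?thesis using h q sc by simp
  qed
  ultimately show thesis using that by blast
qed

lemma composable_cases:
  assumes "composable PG x y"
  obtains a b c where "a \<in> carrier G - H" "b \<in> carrier G - H" "c \<in> carrier G - H"
    "x = orb a b" "y = orb b c"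
proof -
  have "x \<in> Mor PG" using assms by (simp add: composable_def)
  then obtain a b where ab: "a \<in> carrier G - H" "b \<in> carrier G - H" and x: "x = orb a b"
    by (rule Mor_cases)
  obtain c where "c \<in> carrier G - H" "y = orb b c"
    using assms[unfolded x] ab by (rule composable_orb_left_cases)
  then show thesis using ab x by (intro that)
qed

section \<open>The groupoid axioms\<close>

lemma groupoid_PG: "groupoid PG"
proof
  fix x assume "x \<in> Mor PG"
  then obtain a b where "a \<in> carrier G - H" "b \<in> carrier G - H" "x = orb a b"
    by (rule Mor_cases)
  then show "Dom PG x \<in> Obj PG" "Cod PG x \<in> Obj PG"
    "Idm PG (Dom PG x) \<cdot>\<^bsub>PG\<^esub> x = x" "x \<cdot>\<^bsub>PG\<^esub> Idm PG (Cod PG x) = x"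
    "Inv PG x \<in> Mor PG" "Dom PG (Inv PG x) = Cod PG x" "Cod PG (Inv PG x) = Dom PG x"
    "x \<cdot>\<^bsub>PG\<^esub> Inv PG x = Idm PG (Dom PG x)" "Inv PG x \<cdot>\<^bsub>PG\<^esub> x = Idm PG (Cod PG x)"
    by (simp_all only: Dom_orb Cod_orb Inv_orb Idm_double_coset Comp_orb orb_in_Mor
        double_coset_in_Obj)
next
  fix A assume "A \<in> Obj PG"
  then obtain a where "a \<in> carrier G - H" "A = double_coset G H a"
    by (rule Obj_cases)
  then show "Idm PG A \<in> Mor PG" "Dom PG (Idm PG A) = A" "Cod PG (Idm PG A) = A"
    by (simp_all only: Dom_orb Cod_orb Idm_double_coset orb_in_Mor)
next
  fix x y assume "composable PG x y"
  then obtain a b c where "a \<in> carrier G - H" "b \<in> carrier G - H" "c \<in> carrier G - H"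
    "x = orb a b" "y = orb b c"
    by (rule composable_cases)
  then show "x \<cdot>\<^bsub>PG\<^esub> y \<in> Mor PG" "Dom PG (x \<cdot>\<^bsub>PG\<^esub> y) = Dom PG x"
    "Cod PG (x \<cdot>\<^bsub>PG\<^esub> y) = Cod PG y"
    by (simp_all only: Dom_orb Cod_orb Comp_orb orb_in_Mor)
next
  fix x y z assume xy: "composable PG x y" and yz: "composable PG y z"
  obtain a b c where abc: "a \<in> carrier G - H" "b \<in> carrier G - H" "c \<in> carrier G - H"
    "x = orb a b" "y = orb b c"
    using xy by (rule composable_cases)
  \<comment> \<open>Aligning \<open>z\<close> with the pair (b, c) already chosen for
    \<open>y\<close> yields one chain a, b, c, d, on which both bracketings are [a, d].\<close>
  obtain d where "d \<in> carrier G - H" "z = orb c d"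
    using yz[unfolded abc(5)] abc(2,3) by (rule composable_orb_left_cases)
  then show "x \<cdot>\<^bsub>PG\<^esub> y \<cdot>\<^bsub>PG\<^esub> z = x \<cdot>\<^bsub>PG\<^esub> (y \<cdot>\<^bsub>PG\<^esub> z)"
    using abc by (simp only: Comp_orb)
qed

section \<open>Non-identity morphisms\<close>

text \<open>Every pair in the orbit of (g, g) has the form (h1^-1 g h2, h1^-1 g h3), with quotient
  h2^-1 h3 in \<open>H\<close>. Conversely, if a^-1 b lies in \<open>H\<close>, the action of (1, 1,
  a^-1 b) moves (a, a) to (a, b).\<close>

lemma orb_in_non_identities_iff:
  assumes a: "a \<in> carrier G - H" and b: "b \<in> carrier G - H"
  shows "orb a b \<in> non_identities PG \<longleftrightarrow> inv a \<otimes> b \<notin> H"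
proof -
  note sc = subgroup.mem_carrier[OF H]
  have "inv a \<otimes> b \<in> H" if A: "A \<in> Obj PG" "orb a b = Idm PG A" for A
  proof -
    obtain g where g: "g \<in> carrier G - H" "A = double_coset G H g"
      using A(1) by (rule Obj_cases)
    have "(a, b) \<in> orb g g"
      using A(2) pair_orbit_self[OF H, of a b] a b g Idm_double_coset by auto
    then obtain h1 h2 h3 where h: "h1 \<in> H" "h2 \<in> H" "h3 \<in> H"
      "a = inv h1 \<otimes> g \<otimes> h2" "b = inv h1 \<otimes> g \<otimes> h3"
      unfolding pair_orbit_mem by blast
    have "inv a \<otimes> b = inv h2 \<otimes> h3"
      unfolding h(4,5) using h(1-3) g(1) sc
      by (simp add: m_assoc inv_mult_group inv_mult_cancel)
    then show ?thesis
      using h(2,3) subgroup.m_closed[OF H] subgroup.m_inv_closed[OF H] by simp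
  qed
  moreover have "orb a b \<in> Idm PG ` Obj PG" if h: "inv a \<otimes> b \<in> H"
  proof -
    have "a = inv \<one> \<otimes> a \<otimes> \<one>" "b = inv \<one> \<otimes> a \<otimes> (inv a \<otimes> b)"
      using a b by (simp_all add: inv_mult_cancel)
    then have "(a, b) \<in> orb a a"
      unfolding pair_orbit_mem using h subgroup.one_closed[OF H] by blast
    then have "orb a b = orb a a"
      using pair_orbit_eq[OF H] a by blast
    then show ?thesis
      using Idm_double_coset[OF a] double_coset_in_Obj[OF a] by (metis imageI)
  qed
  ultimately show ?thesis
    using orb_in_Mor[OF a b] by (auto simp: non_identities_def)
qed

text \<open>The quotient is listed as an element of \<open>carrier G - H\<close> because j makes it
  a component of a new pair.\<close>

lemma non_identities_cases:
  assumes "x \<in> non_identities PG"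
  obtains a b where "a \<in> carrier G - H" "b \<in> carrier G - H" "inv a \<otimes> b \<in> carrier G - H"
    "x = orb a b"
proof -
  have "x \<in> Mor PG" using assms by (simp add: non_identities_def)
  then obtain a b where "a \<in> carrier G - H" "b \<in> carrier G - H" "x = orb a b"
    by (rule Mor_cases)
  then show thesis using that assms orb_in_non_identities_iff by auto
qed

lemma non_identities_I:
  "a \<in> carrier G - H \<Longrightarrow> b \<in> carrier G - H \<Longrightarrow> inv a \<otimes> b \<in> carrier G - H
    \<Longrightarrow> orb a b \<in> non_identities PG"
  by (simp add: orb_in_non_identities_iff)

section \<open>The maps j and k on representatives\<close>

text \<open>Changing (a, b) by (h1, h2, h3) changes (a^-1, a^-1 b) by (h2, h1, h3): inversion
  exchanges the two factors around a, and h1 cancels in the quotient. So the orbit of the image does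
  not depend on the representative.\<close>

lemma pair_j_orb:
  assumes a: "a \<in> carrier G" and b: "b \<in> carrier G"
  shows "pair_j G H (orb a b) = orb (inv a) (inv a \<otimes> b)"
proof -
  note sc = subgroup.mem_carrier[OF H]
  have "orb (inv c) (inv c \<otimes> d) = orb (inv a) (inv a \<otimes> b)" if "(c, d) \<in> orb a b" for c d
  proof -
    obtain h1 h2 h3 where h: "h1 \<in> H" "h2 \<in> H" "h3 \<in> H"
      "c = inv h1 \<otimes> a \<otimes> h2" "d = inv h1 \<otimes> b \<otimes> h3"
      using \<open>(c, d) \<in> orb a b\<close> unfolding pair_orbit_mem by blast
    have "inv c = inv h2 \<otimes> inv a \<otimes> h1" "inv c \<otimes> d = inv h2 \<otimes> (inv a \<otimes> b) \<otimes> h3"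
      unfolding h(4,5) using h(1-3) a b sc
      by (simp_all add: m_assoc inv_mult_group inv_mult_cancel)
    then have "(inv c, inv c \<otimes> d) \<in> orb (inv a) (inv a \<otimes> b)"
      unfolding pair_orbit_mem using h by blast
    then show ?thesis using a b by (intro pair_orbit_eq[OF H]) auto
  qed
  then have "{orb (inv c) (inv c \<otimes> d) | c d. (c, d) \<in> orb a b} = {orb (inv a) (inv a \<otimes> b)}"
    using pair_orbit_self[OF H a b] by blast
  then show ?thesis by (simp add: pair_j_def)
qed

text \<open>The three maps i, j, i send (a, b) to (b, a), then to (b^-1, b^-1 a), then to (b^-1 a,
  b^-1).\<close>

lemma conj_inv_orb:
  assumes "a \<in> carrier G - H" "b \<in> carrier G - H" "inv a \<otimes> b \<in> carrier G - H"
  shows "conj_inv PG (pair_j G H) (orb a b) = orb (inv b \<otimes> a) (inv b)"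
  using assms left_quotient_swap_notin_subgroup[OF H, of a b] inv_notin_subgroup[OF H, of b]
  by (simp add: conj_inv_def Inv_orb pair_j_orb)

text \<open>Axiom (iv) on aligned representatives: the conditions on the three quotients say that
  [a, b], [b, c] and their product [a, c] are non-identities. The composability claim holds because
  c^-1 is both the second component for k [a, c] and the first for the inverse of k [b, c].\<close>

lemma conj_inv_Comp:
  assumes a: "a \<in> carrier G - H" and b: "b \<in> carrier G - H" and c: "c \<in> carrier G - H"
    and ab: "inv a \<otimes> b \<in> carrier G - H" and bc: "inv b \<otimes> c \<in> carrier G - H"
    and ac: "inv a \<otimes> c \<in> carrier G - H"
  defines "k \<equiv> conj_inv PG (pair_j G H)"
  shows "k (orb a b) \<cdot>\<^bsub>PG\<^esub> pair_j G H (orb b c) = orb (inv b \<otimes> a) (inv b \<otimes> c)"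
    and "orb (inv b \<otimes> a) (inv b \<otimes> c) \<in> non_identities PG"
    and "composable PG (k (orb a c)) (Inv PG (k (orb b c)))"
    and "k (orb a c) \<cdot>\<^bsub>PG\<^esub> Inv PG (k (orb b c)) = k (orb (inv b \<otimes> a) (inv b \<otimes> c))"
proof -
  have inv: "inv a \<in> carrier G - H" "inv b \<in> carrier G - H" "inv c \<in> carrier G - H"
    using a b c inv_notin_subgroup[OF H] by blast+
  have swap: "inv b \<otimes> a \<in> carrier G - H" "inv c \<otimes> b \<in> carrier G - H"
    "inv c \<otimes> a \<in> carrier G - H"
    using a b c ab bc ac left_quotient_swap_notin_subgroup[OF H, of a b]
      left_quotient_swap_notin_subgroup[OF H, of b c] left_quotient_swap_notin_subgroup[OF H, of a c]
    by auto
  \<comment> \<open>In each product b cancels. The first equation gives the non-identity condition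
    on [b^-1 a, b^-1 c]; the other two evaluate k on it.\<close>
  have quot: "inv (inv b \<otimes> a) \<otimes> (inv b \<otimes> c) = inv a \<otimes> c"
    "inv c \<otimes> b \<otimes> (inv b \<otimes> a) = inv c \<otimes> a" "inv (inv b \<otimes> c) = inv c \<otimes> b"
    using a b c by (simp_all add: m_assoc inv_mult_group inv_mult_cancel)
  have kj: "k (orb a b) = orb (inv b \<otimes> a) (inv b)" "k (orb a c) = orb (inv c \<otimes> a) (inv c)"
    "k (orb b c) = orb (inv c \<otimes> b) (inv c)" "pair_j G H (orb b c) = orb (inv b) (inv b \<otimes> c)"
    "k (orb (inv b \<otimes> a) (inv b \<otimes> c)) = orb (inv c \<otimes> a) (inv c \<otimes> b)"
    using a b c ab bc ac swap unfolding k_def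
    by (simp_all add: conj_inv_orb pair_j_orb quot)
  show "k (orb a b) \<cdot>\<^bsub>PG\<^esub> pair_j G H (orb b c) = orb (inv b \<otimes> a) (inv b \<otimes> c)"
    using kj inv swap bc by (simp only: Comp_orb)
  show "orb (inv b \<otimes> a) (inv b \<otimes> c) \<in> non_identities PG"
    using non_identities_I swap bc ac quot by simp
  show "composable PG (k (orb a c)) (Inv PG (k (orb b c)))"
    using kj inv swap by (simp only: Inv_orb composable_orb)
  show "k (orb a c) \<cdot>\<^bsub>PG\<^esub> Inv PG (k (orb b c)) = k (orb (inv b \<otimes> a) (inv b \<otimes> c))"
    using kj inv swap by (simp only: Inv_orb Comp_orb)
qed

section \<open>The axioms of a Delta-groupoid\<close>

lemma non_identities_composable_cases:
  assumes "x \<in> non_identities PG" "y \<in> non_identities PG" "composable PG x y"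
  obtains a b c where "a \<in> carrier G - H" "b \<in> carrier G - H" "c \<in> carrier G - H"
    "inv a \<otimes> b \<in> carrier G - H" "inv b \<otimes> c \<in> carrier G - H" "x = orb a b" "y = orb b c"
proof -
  obtain a b c where "a \<in> carrier G - H" "b \<in> carrier G - H" "c \<in> carrier G - H"
    "x = orb a b" "y = orb b c"
    using assms(3) by (rule composable_cases)
  then show thesis using that assms(1,2) orb_in_non_identities_iff by auto
qed

lemma D_composable_cases:
  assumes "D_composable PG (non_identities PG) x y"
  obtains a b c where "a \<in> carrier G - H" "b \<in> carrier G - H" "c \<in> carrier G - H"
    "inv a \<otimes> b \<in> carrier G - H" "inv b \<otimes> c \<in> carrier G - H" "inv a \<otimes> c \<in> carrier G - H"
    "x = orb a b" "y = orb b c" "x \<cdot>\<^bsub>PG\<^esub> y = orb a c"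
proof -
  have D: "x \<in> non_identities PG" "y \<in> non_identities PG" "composable PG x y"
    and xy: "x \<cdot>\<^bsub>PG\<^esub> y \<in> non_identities PG"
    using assms by (simp_all add: D_composable_def)
  obtain a b c where abc: "a \<in> carrier G - H" "b \<in> carrier G - H" "c \<in> carrier G - H"
    "inv a \<otimes> b \<in> carrier G - H" "inv b \<otimes> c \<in> carrier G - H" "x = orb a b" "y = orb b c"
    using D by (rule non_identities_composable_cases)
  moreover have "x \<cdot>\<^bsub>PG\<^esub> y = orb a c" using abc by (simp only: Comp_orb)
  moreover have "inv a \<otimes> c \<in> carrier G - H"
    using calculation xy orb_in_non_identities_iff by auto
  ultimately show thesis using that by blast
qed

text \<open>The condition on [a, b] puts a^-1 b outside \<open>H\<close>, so the image is a
  morphism. The quotient of (a^-1, a^-1 b) is b, again outside \<open>H\<close>, so the image is not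
  an identity.\<close>

lemma pair_j_in_non_identities:
  assumes "x \<in> non_identities PG"
  shows "pair_j G H x \<in> non_identities PG"
proof -
  obtain a b where "a \<in> carrier G - H" "b \<in> carrier G - H" "inv a \<otimes> b \<in> carrier G - H"
    "x = orb a b"
    using assms by (rule non_identities_cases)
  then show ?thesis
    using inv_notin_subgroup[OF H, of a]
    by (auto simp: pair_j_orb inv_mult_cancel intro!: non_identities_I)
qed

lemma Inv_in_non_identities:
  assumes "x \<in> non_identities PG"
  shows "Inv PG x \<in> non_identities PG" and "Inv PG (Inv PG x) = x"
proof -
  obtain a b where "a \<in> carrier G - H" "b \<in> carrier G - H" "inv a \<otimes> b \<in> carrier G - H"
    "x = orb a b"
    using assms by (rule non_identities_cases)
  then show "Inv PG x \<in> non_identities PG" "Inv PG (Inv PG x) = x"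
    using left_quotient_swap_notin_subgroup[OF H, of a b]
    by (auto simp: Inv_orb intro!: non_identities_I)
qed

text \<open>The images k [a, b] and j [b, c] are aligned at b^-1.\<close>

lemma composable_conj_inv_pair_j:
  assumes "x \<in> non_identities PG" "y \<in> non_identities PG" "composable PG x y"
  shows "composable PG (conj_inv PG (pair_j G H) x) (pair_j G H y)"
proof -
  obtain a b c where "a \<in> carrier G - H" "b \<in> carrier G - H" "c \<in> carrier G - H"
    "inv a \<otimes> b \<in> carrier G - H" "inv b \<otimes> c \<in> carrier G - H" "x = orb a b" "y = orb b c"
    using assms by (rule non_identities_composable_cases)
  then show ?thesis
    using inv_notin_subgroup[OF H, of b] left_quotient_swap_notin_subgroup[OF H, of a b]
    by (simp add: conj_inv_orb pair_j_orb composable_orb)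
qed

lemma delta_groupoid_PG: "delta_groupoid PG (non_identities PG) (pair_j G H)"
proof (intro delta_groupoid.intro groupoid_PG delta_groupoid_axioms.intro)
  interpret PG: groupoid PG by (rule groupoid_PG)
  let ?D = "non_identities PG" and ?j = "pair_j G H" and ?k = "conj_inv PG (pair_j G H)"
  show DM: "?D \<subseteq> Mor PG" by (auto simp: non_identities_def)
  have "x \<in> Mor PG" if "x \<in> groupoid_generate PG ?D" for x
    using that DM
    by induction (auto intro: PG.Idm_closed PG.Inv_closed PG.Comp_closed)
  \<comment> \<open>A morphism is either an identity, which is generated as an empty product, or an
    element of the generating set itself.\<close>
  moreover have "x \<in> groupoid_generate PG ?D" if "x \<in> Mor PG" for x
    using that groupoid_generate.Idm[of _ PG ?D] groupoid_generate.incl[of x ?D PG]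
    by (auto simp: non_identities_def)
  ultimately show "groupoid_generate PG ?D = Mor PG" by blast
  have "Inv PG x \<in> ?D" if "x \<in> ?D" for x
    using Inv_in_non_identities(1) that .
  \<comment> \<open>Since inversion is an involution, x is the image of its own inverse.\<close>
  moreover have "x \<in> Inv PG ` ?D" if "x \<in> ?D" for x
    using Inv_in_non_identities[OF that] by (metis imageI)
  ultimately show "Inv PG ` ?D = ?D" by blast
  have kD: "?k x \<in> ?D" if "x \<in> ?D" for x
    unfolding conj_inv_def
    using that by (intro Inv_in_non_identities pair_j_in_non_identities)
  show "?j x \<in> ?D" if "x \<in> ?D" for x
    using that by (rule pair_j_in_non_identities)
  show "?j (?j x) = x" and "Inv PG (?j (Inv PG x)) = ?j (Inv PG (?j x))" if x: "x \<in> ?D" for x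
  proof -
    obtain a b where ab: "a \<in> carrier G - H" "b \<in> carrier G - H" "inv a \<otimes> b \<in> carrier G - H"
      "x = orb a b"
      using x by (rule non_identities_cases)
    show "?j (?j x) = x"
      using ab by (simp add: pair_j_orb inv_mult_cancel)
    \<comment> \<open>From j [a, b] = [a^-1, a^-1 b], inversion and j give the first component b^-1
      a and the second (b^-1 a) a^-1. Conjugating by normality is not possible here, but a
      commutation is avoided by writing b^-1 a a^-1 = b^-1, so this agrees with k [a, b].\<close>
    have "?j (Inv PG (?j x)) = orb (inv b \<otimes> a) (inv b)"
      using ab inv_notin_subgroup[OF H, of a]
      by (simp add: pair_j_orb Inv_orb inv_mult_group m_assoc)
    then show "Inv PG (?j (Inv PG x)) = ?j (Inv PG (?j x))"
      using conj_inv_orb ab by (simp add: conj_inv_def)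
  qed
  show "composable PG (?k x) (?j y)" if "x \<in> ?D" "y \<in> ?D" "composable PG x y" for x y
    using that by (rule composable_conj_inv_pair_j)
  fix x y assume xy: "D_composable PG ?D x y"
  then obtain a b c where abc: "a \<in> carrier G - H" "b \<in> carrier G - H" "c \<in> carrier G - H"
    "inv a \<otimes> b \<in> carrier G - H" "inv b \<otimes> c \<in> carrier G - H" "inv a \<otimes> c \<in> carrier G - H"
    and reps: "x = orb a b" "y = orb b c" "x \<cdot>\<^bsub>PG\<^esub> y = orb a c"
    by (rule D_composable_cases)
  note comp = conj_inv_Comp[OF abc, folded reps]
  show "D_composable PG ?D (?k x) (?j y)"
    using xy comp(1,2) kD pair_j_in_non_identities composable_conj_inv_pair_j
    by (simp add: D_composable_def)
  show "composable PG (?k (x \<cdot>\<^bsub>PG\<^esub> y)) (Inv PG (?k y))"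
    using comp(3) .
  show "?k (x \<cdot>\<^bsub>PG\<^esub> y) \<cdot>\<^bsub>PG\<^esub> Inv PG (?k y) = ?k (?k x \<cdot>\<^bsub>PG\<^esub> ?j y)"
    using comp(1,4) by simp
qed

end

theorem proposition1:
  fixes G :: "('a, 'b) monoid_scheme" (structure) and H :: "'a set"
  assumes "group G"
    and "malnormal H G"
  shows "delta_groupoid (pair_groupoid G H) (non_identities (pair_groupoid G H)) (pair_j G H) \<and>
    (\<forall>g1 \<in> carrier G - H. \<forall>g2 \<in> carrier G - H.
       pair_orbit G H g1 g2 \<in> non_identities (pair_groupoid G H) \<longrightarrow>
       pair_j G H (pair_orbit G H g1 g2) = pair_orbit G H (inv g1) (inv g1 \<otimes> g2))"
proof -
  interpret malnormal_subgroup G H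
    using assms by (simp add: malnormal_subgroup_def malnormal_subgroup_axioms_def)
  show ?thesis using delta_groupoid_PG pair_j_orb by blast
qed

end
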